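(* Let $k$ be a field, $q\in k\setminus\{0\}$, and $\Lambda=\Lambda(q)$. A left $\Lambda$-module of dimension at most $3$ is annihilated by $\operatorname{rad}^2\Lambda$; thus it is a module of Loewy length at most $2$.
   Context: $\Lambda=\Lambda(q)$ is the 6-dimensional local $k$-algebra generated by $x,y,z$ with relations $x^2=y^2=z^2=yz=0$, $xy+qyx=0$, $xz-zx=0$, $zy-zx=0$; it has $k$-basis $1,x,y,z,yx,zx$, $\operatorname{rad}\Lambda$ has basis $x,y,z,yx,zx$, and $\operatorname{rad}^2\Lambda=\operatorname{soc}\Lambda$ has basis $yx,zx$. *)

theory Defs
  imports
    "HOL-Library.Poly_Mapping"
    "HOL-Library.Extended_Nat"
    "HOL-Algebra.Algebra"
    "HOL-Algebra.Algebraic_Closure_Type"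
    "Jordan_Normal_Form.Missing_VectorSpace"
begin

section \<open>Left modules over a (not necessarily commutative) ring\<close>

text \<open>
  The locale of modules in \<open>HOL-Algebra\<close> requires a commutative ring of scalars.
  The following is the same list of axioms over an arbitrary ring; only the commutativity
  of the ring is dropped.
\<close>

locale left_module = R?: ring R + M?: abelian_group M
  for R :: "('a, 'c) ring_scheme" (structure) and M :: "('a, 'b, 'd) module_scheme" (structure) +
  assumes smult_closed [simp, intro]:
      "\<lbrakk>a \<in> carrier R; x \<in> carrier M\<rbrakk> \<Longrightarrow> a \<odot>\<^bsub>M\<^esub> x \<in> carrier M"
    and smult_l_distr:
      "\<lbrakk>a \<in> carrier R; b \<in> carrier R; x \<in> carrier M\<rbrakk> \<Longrightarrow>
      (a \<oplus> b) \<odot>\<^bsub>M\<^esub> x = a \<odot>\<^bsub>M\<^esub> x \<oplus>\<^bsub>M\<^esub> b \<odot>\<^bsub>M\<^esub> x"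
    and smult_r_distr:
      "\<lbrakk>a \<in> carrier R; x \<in> carrier M; y \<in> carrier M\<rbrakk> \<Longrightarrow>
      a \<odot>\<^bsub>M\<^esub> (x \<oplus>\<^bsub>M\<^esub> y) = a \<odot>\<^bsub>M\<^esub> x \<oplus>\<^bsub>M\<^esub> a \<odot>\<^bsub>M\<^esub> y"
    and smult_assoc1:
      "\<lbrakk>a \<in> carrier R; b \<in> carrier R; x \<in> carrier M\<rbrakk> \<Longrightarrow>
      (a \<otimes> b) \<odot>\<^bsub>M\<^esub> x = a \<odot>\<^bsub>M\<^esub> (b \<odot>\<^bsub>M\<^esub> x)"
    and smult_one [simp]:
      "x \<in> carrier M \<Longrightarrow> \<one> \<odot>\<^bsub>M\<^esub> x = x"

definition regular_module :: "('a, 'c) ring_scheme \<Rightarrow> ('a, 'a) module" where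
  "regular_module R =
     \<lparr>carrier = carrier R, monoid.mult = monoid.mult R, one = one R,
      ring.zero = ring.zero R, add = add R, module.smult = monoid.mult R\<rparr>"

text \<open>
  \<open>VectorSpace\<close> declares a second constant \<open>submodule\<close>, which presupposes a commutative ring;
  hence the qualified name below.
\<close>

definition maximal_submodule ::
    "'b set \<Rightarrow> ('a, 'c) ring_scheme \<Rightarrow> ('a, 'b, 'd) module_scheme \<Rightarrow> bool" where
  "maximal_submodule U R M \<longleftrightarrow>
     Module.submodule U R M \<and> U \<noteq> carrier M \<and>
     (\<forall>W. Module.submodule W R M \<longrightarrow> U \<subseteq> W \<longrightarrow> W = U \<or> W = carrier M)"

text \<open>A module without maximal submodules is its own radical.\<close>

definition module_radical ::
    "('a, 'c) ring_scheme \<Rightarrow> ('a, 'b, 'd) module_scheme \<Rightarrow> 'b set" where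
  "module_radical R M = carrier M \<inter> \<Inter>{U. maximal_submodule U R M}"

text \<open>The Jacobson radical: the intersection of all maximal left ideals.\<close>

definition ring_radical :: "('a, 'c) ring_scheme \<Rightarrow> 'a set" where
  "ring_radical R = module_radical R (regular_module R)"

primrec radical_series ::
    "('a, 'c) ring_scheme \<Rightarrow> ('a, 'b, 'd) module_scheme \<Rightarrow> nat \<Rightarrow> 'b set" where
  "radical_series R M 0 = carrier M"
| "radical_series R M (Suc n) = module_radical R (M\<lparr>carrier := radical_series R M n\<rparr>)"

text \<open>The Loewy length is \<open>\<infinity>\<close> if the radical series does not reach zero.\<close>

definition loewy_length ::
    "('a, 'c) ring_scheme \<Rightarrow> ('a, 'b, 'd) module_scheme \<Rightarrow> enat" where
  "loewy_length R M = (INF n \<in> {n. radical_series R M n = {\<zero>\<^bsub>M\<^esub>}}. enat n)"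

definition restrict_scalars ::
    "('c \<Rightarrow> 'a) \<Rightarrow> ('a, 'b, 'd) module_scheme \<Rightarrow> ('c, 'b) module" where
  "restrict_scalars h M =
     \<lparr>carrier = carrier M, monoid.mult = monoid.mult M, one = one M,
      ring.zero = ring.zero M, add = add M, module.smult = (\<lambda>c x. h c \<odot>\<^bsub>M\<^esub> x)\<rparr>"

section \<open>Free associative algebras\<close>

text \<open>
  The free algebra over \<open>'k\<close> on the set \<open>'a\<close> is the monoid algebra of the free monoid on \<open>'a\<close>.
  The multiplication of \<^typ>\<open>'a \<Rightarrow>\<^sub>0 'b\<close> is convolution with respect to an additively written
  monoid, so concatenation of words is written as addition.
\<close>

datatype 'a free_monoid = Word (letters: "'a list")

instantiation free_monoid :: (type) monoid_add
begin

definition "0 = Word []"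

definition "v + w = Word (letters v @ letters w)"

instance
  by standard (simp_all add: zero_free_monoid_def plus_free_monoid_def)

end

type_synonym ('a, 'k) free_algebra = "'a free_monoid \<Rightarrow>\<^sub>0 'k"

definition gen :: "'a \<Rightarrow> ('a, 'k::field) free_algebra" where
  "gen a = Poly_Mapping.single (Word [a]) 1"

definition const :: "'k::field \<Rightarrow> ('a, 'k) free_algebra" where
  "const c = Poly_Mapping.single 0 c"

section \<open>The algebra \<open>\<Lambda>(q)\<close>\<close>

datatype xyz = X_gen | Y_gen | Z_gen

definition Lambda_relations :: "'k::field \<Rightarrow> (xyz, 'k) free_algebra set" where
  "Lambda_relations q =
     (let x = gen X_gen; y = gen Y_gen; z = gen Z_gen in
      {x * x, y * y, z * z, y * z, x * y + const q * y * x, x * z - z * x, z * y - z * x})"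

definition Lambda_ideal :: "'k::field \<Rightarrow> (xyz, 'k) free_algebra set" where
  "Lambda_ideal q = Idl\<^bsub>ring_of_type_algebra\<^esub> (Lambda_relations q)"

definition Lambda :: "'k::field \<Rightarrow> (xyz, 'k) free_algebra set ring" where
  "Lambda q = ring_of_type_algebra Quot Lambda_ideal q"

definition Lambda_scalar :: "'k::field \<Rightarrow> 'k \<Rightarrow> (xyz, 'k) free_algebra set" where
  "Lambda_scalar q c = Lambda_ideal q +>\<^bsub>ring_of_type_algebra\<^esub> const c"

text \<open>A \<open>\<Lambda>(q)\<close>-module is a vector space over \<open>'k\<close> through the structure map of \<open>\<Lambda>(q)\<close>.\<close>

abbreviation underlying_space ::
    "'k::field \<Rightarrow> ((xyz, 'k) free_algebra set, 'm, 'd) module_scheme \<Rightarrow> ('k, 'm) module" where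
  "underlying_space q M \<equiv> restrict_scalars (Lambda_scalar q) M"

lemma ring_free_algebra: "ring (ring_of_type_algebra :: 'a::ring_1 ring)"
proof -
  have "\<exists>y. x + y = 0" for x :: 'a
    using add.right_inverse by blast
  thus ?thesis
    unfolding ring_of_type_algebra_def using add.right_inverse
    by unfold_locales (auto simp: algebra_simps Units_def)
qed

lemma ideal_Lambda_ideal: "ideal (Lambda_ideal q) ring_of_type_algebra"
  unfolding Lambda_ideal_def
  by (rule ring.genideal_ideal[OF ring_free_algebra]) (simp add: ring_of_type_algebra_def)

lemma ring_Lambda: "ring (Lambda q)"
  unfolding Lambda_def by (rule ideal.quotient_is_ring[OF ideal_Lambda_ideal])

lemma ring_hom_Lambda_scalar: "Lambda_scalar q \<in> ring_hom ring_of_type_algebra (Lambda q)"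
proof -
  let ?F = "ring_of_type_algebra :: (xyz, 'a) free_algebra ring"
  have 1: "const \<in> ring_hom (ring_of_type_algebra :: 'a ring) ?F"
    by (rule ring_hom_memI)
      (simp_all add: ring_of_type_algebra_def const_def mult_single single_add)
  have 2: "(+>\<^bsub>?F\<^esub>) (Lambda_ideal q) \<in> ring_hom ?F (Lambda q)"
    unfolding Lambda_def by (rule ideal.rcos_ring_hom[OF ideal_Lambda_ideal])
  show ?thesis
    using ring_hom_trans[OF 1 2] by (simp add: Lambda_scalar_def[abs_def] comp_def)
qed

lemma vectorspace_underlying_space:
  assumes "left_module (Lambda q) M"
  shows "vectorspace ring_of_type_algebra (underlying_space q M)"
proof -
  interpret left_module "Lambda q" M by fact
  let ?K = "ring_of_type_algebra :: 'a ring"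
  note h = ring_hom_Lambda_scalar[of q]
  have K: "field ?K" by (rule field_from_type_algebra)
  have cl: "Lambda_scalar q c \<in> carrier (Lambda q)" for c
    using ring_hom_closed[OF h, of c] by (simp add: ring_of_type_algebra_def)
  have ab: "abelian_group (underlying_space q M)"
    by (rule abelian_groupI)
      (auto simp: restrict_scalars_def M.a_assoc M.a_comm M.a_lcomm intro: M.l_neg
        intro!: bexI[where x = "\<ominus>\<^bsub>M\<^esub> x" for x])
  have "module ?K (underlying_space q M)"
  proof (rule moduleI)
    show "cring ?K" by (rule cring_from_type_algebra)
  qed (use ab in \<open>simp_all add: restrict_scalars_def cl smult_l_distr smult_r_distr smult_assoc1
        ring_hom_add[OF h] ring_hom_mult[OF h] ring_hom_one[OF h]\<close>)
  with K show ?thesis by (simp add: vectorspace_def)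
qed

end

theory Submission
  imports Defs
begin

text \<open>
  The free algebra acts on every \<open>\<Lambda>(q)\<close>-module through the class map, so a module is a vector
  space with three operators \<open>x\<close>, \<open>y\<close>, \<open>z\<close> subject to the
  seven relations. Of the nine words of length two, \<open>xx\<close>, \<open>yy\<close>, \<open>zz\<close>, \<open>yz\<close> act as zero by
  definition, and \<open>xy\<close>, \<open>xz\<close>, \<open>zy\<close> are multiples of \<open>yx\<close> and \<open>zx\<close>. Only \<open>yx\<close> and \<open>zx\<close>
  need the bound on the dimension.

  Let \<open>t\<close> be one of \<open>y\<close>, \<open>z\<close>. Then \<open>x\<^sup>2 = t\<^sup>2 = 0\<close> and \<open>xt = c tx\<close> with \<open>c \<noteq> 0\<close>: here \<open>c = -q\<close> for
  \<open>t = y\<close>, which is where \<open>q \<noteq> 0\<close> enters, and \<open>c = 1\<close> for \<open>t = z\<close>. So \<open>x\<close> and \<open>t\<close> generate an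
  image of a quantum exterior algebra in two variables. This four-dimensional algebra is
  local and Frobenius with socle spanned by \<open>tx\<close>; hence if \<open>tx v \<noteq> 0\<close>, the vector \<open>v\<close> generates
  a free submodule, and \<open>v\<close>, \<open>xv\<close>, \<open>tv\<close>, \<open>txv\<close> are linearly independent
  (\<open>independent_of_quantum_exterior\<close>). In dimension at most three, all words of length at least
  two therefore act as zero.

  It remains to relate words to radicals. Call the coefficient of the empty word the
  augmentation. If the elements of augmentation zero map a module \<open>M\<close> into a submodule \<open>P\<close>,
  then \<open>\<Lambda>(q)\<close> acts on \<open>M / P\<close> through scalars, so \<open>M / P\<close> is a vector space whose hyperplanes are
  maximal submodules with zero intersection, and \<open>rad M \<subseteq> P\<close> (\<open>module_radical_subset\<close>).
  This is used three times. For the regular module and the classes of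
  augmentation zero, it shows that \<open>rad \<Lambda>(q)\<close> consists of such classes, so that products of two
  of its elements kill \<open>M\<close>. For \<open>M\<close> and the submodule \<open>S\<close> of vectors killed by \<open>x\<close>, \<open>y\<close>, \<open>z\<close> it gives
  \<open>rad M \<subseteq> S\<close>, and for \<open>rad M\<close> and the zero submodule it gives \<open>rad (rad M) = 0\<close>.
\<close>

section \<open>The augmentation of the free algebra\<close>

text \<open>
  The elements supported in a fixed set \<open>K\<close> are sums of monomials from \<open>K\<close>. Taking for \<open>K\<close> the
  nonempty words reduces statements about augmentation zero to single words.
\<close>

lemma poly_mapping_additive_induct [consumes 1, case_names zero single add]:
  fixes f :: "'a \<Rightarrow>\<^sub>0 'b::comm_monoid_add"
  assumes f: "Poly_Mapping.keys f \<subseteq> K"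
    and zero: "P 0"
    and single: "\<And>w c. w \<in> K \<Longrightarrow> P (Poly_Mapping.single w c)"
    and add: "\<And>g h. P g \<Longrightarrow> P h \<Longrightarrow> P (g + h)"
  shows "P f"
  using f
proof (induction f rule: Poly_Mapping.update_induct)
  case const
  show ?case by (rule zero)
next
  case (update f a b)
  have eq: "Poly_Mapping.update a b f = f + Poly_Mapping.single a b"
    using update.hyps(1)
    by (intro poly_mapping_eqI)
      (auto simp: lookup_update lookup_add lookup_single when_def in_keys_iff)
  have "a \<in> K" "Poly_Mapping.keys f \<subseteq> K"
    using update.prems update.hyps by (auto simp: keys_update split: if_splits)
  then show ?case
    unfolding eq by (intro add update.IH single)
qed

lemma free_monoid_add_eq_0_iff: "v + w = 0 \<longleftrightarrow> v = 0 \<and> w = (0 :: 'a free_monoid)"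
  by (cases v; cases w) (auto simp: zero_free_monoid_def plus_free_monoid_def)

abbreviation augmentation :: "('a, 'k::field) free_algebra \<Rightarrow> 'k" where
  "augmentation f \<equiv> Poly_Mapping.lookup f 0"

text \<open>
  The empty word is only the product of two empty words, so the constant term of a product
  comes from the constant terms of its factors.
\<close>

lemma augmentation_mult:
  fixes f g :: "('a, 'k::field) free_algebra"
  shows "augmentation (f * g) = augmentation f * augmentation g"
proof (induction f rule: poly_mapping_additive_induct[OF subset_UNIV])
  case (2 v c)
  show ?case
  proof (induction g rule: poly_mapping_additive_induct[OF subset_UNIV])
    case (2 w d)
    show ?case
      by (simp add: mult_single lookup_single when_def free_monoid_add_eq_0_iff)
  qed (simp_all add: lookup_add algebra_simps)
qed (simp_all add: lookup_add algebra_simps)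

lemma augmentation_const [simp]: "augmentation (const c) = c"
  by (simp add: const_def)

lemma augmentation_gen [simp]: "augmentation (gen a) = 0"
  by (simp add: gen_def lookup_single when_def zero_free_monoid_def)

lemma const_mult_commute:
  fixes f :: "('a, 'k::field) free_algebra"
  shows "const c * f = f * const c"
  by (induction f rule: poly_mapping_additive_induct[OF subset_UNIV])
    (simp_all add: const_def mult_single mult.commute algebra_simps)

lemma const_add: "const (c + d) = const c + const d"
  and const_mult: "const c * const d = const (c * d)"
  by (simp_all add: const_def mult_single single_add)

lemma const_0 [simp]: "const 0 = 0" and const_1 [simp]: "const 1 = 1"
  by (simp_all add: const_def)

lemma single_Cons: "Poly_Mapping.single (Word (g # u)) c = gen g * Poly_Mapping.single (Word u) c"
  and single_snoc: "Poly_Mapping.single (Word (u @ [g])) c = Poly_Mapping.single (Word u) c * gen g"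
  by (simp_all add: gen_def mult_single plus_free_monoid_def)

section \<open>Classes of noncommutative polynomials in \<open>\<Lambda>(q)\<close>\<close>

definition Lambda_class :: "'k::field \<Rightarrow> (xyz, 'k) free_algebra \<Rightarrow> (xyz, 'k) free_algebra set" where
  "Lambda_class q f = Lambda_ideal q +>\<^bsub>ring_of_type_algebra\<^esub> f"

lemma ring_hom_Lambda_class: "Lambda_class q \<in> ring_hom ring_of_type_algebra (Lambda q)"
  unfolding Lambda_class_def Lambda_def
  by (rule ideal.rcos_ring_hom[OF ideal_Lambda_ideal])

lemma
  shows Lambda_class_closed [simp]: "Lambda_class q f \<in> carrier (Lambda q)"
    and Lambda_class_add: "Lambda_class q (f + g) = Lambda_class q f \<oplus>\<^bsub>Lambda q\<^esub> Lambda_class q g"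
    and Lambda_class_mult: "Lambda_class q (f * g) = Lambda_class q f \<otimes>\<^bsub>Lambda q\<^esub> Lambda_class q g"
    and Lambda_class_one: "Lambda_class q 1 = \<one>\<^bsub>Lambda q\<^esub>"
  using ring_hom_closed[OF ring_hom_Lambda_class, of f q]
    ring_hom_add[OF ring_hom_Lambda_class, of f g q]
    ring_hom_mult[OF ring_hom_Lambda_class, of f g q]
    ring_hom_one[OF ring_hom_Lambda_class, of q]
  by (simp_all add: ring_of_type_algebra_def)

lemma Lambda_class_zero: "Lambda_class q 0 = \<zero>\<^bsub>Lambda q\<^esub>"
proof -
  interpret ring "Lambda q" by (rule ring_Lambda)
  have "Lambda_class q 0 \<oplus>\<^bsub>Lambda q\<^esub> Lambda_class q 0 = Lambda_class q 0"
    by (simp flip: Lambda_class_add)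
  then show ?thesis by simp
qed

lemma Lambda_class_relation:
  assumes "r \<in> Lambda_relations q"
  shows "Lambda_class q r = \<zero>\<^bsub>Lambda q\<^esub>"
proof -
  interpret I: ideal "Lambda_ideal q" ring_of_type_algebra by (rule ideal_Lambda_ideal)
  have "r \<in> Lambda_ideal q"
    using assms ring.genideal_self[OF ring_free_algebra, of "Lambda_relations q"]
    by (auto simp: Lambda_ideal_def ring_of_type_algebra_def)
  then show ?thesis
    by (simp add: Lambda_class_def Lambda_def FactRing_def I.a_rcos_const)
qed

lemma Lambda_classE:
  assumes "a \<in> carrier (Lambda q)"
  obtains f where "a = Lambda_class q f"
  using assms
  by (auto simp: Lambda_def FactRing_def A_RCOSETS_def' Lambda_class_def)

lemma Lambda_class_const: "Lambda_class q (const c) = Lambda_scalar q c"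
  by (simp add: Lambda_class_def Lambda_scalar_def)

section \<open>The action of the free algebra on a module\<close>

locale Lambda_module = left_module "Lambda q" M
  for q :: "'k::field" and M :: "((xyz, 'k) free_algebra set, 'm) module"
begin

definition act :: "(xyz, 'k) free_algebra \<Rightarrow> 'm \<Rightarrow> 'm" where
  "act f m = Lambda_class q f \<odot>\<^bsub>M\<^esub> m"

lemma act_closed [simp, intro]: "m \<in> carrier M \<Longrightarrow> act f m \<in> carrier M"
  and act_add: "m \<in> carrier M \<Longrightarrow> act (f + g) m = act f m \<oplus>\<^bsub>M\<^esub> act g m"
  and act_mult: "m \<in> carrier M \<Longrightarrow> act (f * g) m = act f (act g m)"
  and act_one [simp]: "m \<in> carrier M \<Longrightarrow> act 1 m = m"
  and act_add_right: "\<lbrakk>m \<in> carrier M; n \<in> carrier M\<rbrakk> \<Longrightarrow> act f (m \<oplus>\<^bsub>M\<^esub> n) = act f m \<oplus>\<^bsub>M\<^esub> act f n"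
  by (simp_all add: act_def Lambda_class_add Lambda_class_mult Lambda_class_one
      smult_l_distr smult_r_distr smult_assoc1)

lemma act_zero_left [simp]: "m \<in> carrier M \<Longrightarrow> act 0 m = \<zero>\<^bsub>M\<^esub>"
  using act_add[of m 0 0] by simp

lemma act_zero_right [simp]: "act f \<zero>\<^bsub>M\<^esub> = \<zero>\<^bsub>M\<^esub>"
  using act_add_right[of "\<zero>\<^bsub>M\<^esub>" "\<zero>\<^bsub>M\<^esub>" f] by simp

lemma act_minus_one: "m \<in> carrier M \<Longrightarrow> act (- 1) m \<oplus>\<^bsub>M\<^esub> m = \<zero>\<^bsub>M\<^esub>"
  using act_add[of m "- 1" 1] by simp

lemma act_relation:
  assumes "r \<in> Lambda_relations q" "m \<in> carrier M"
  shows "act r m = \<zero>\<^bsub>M\<^esub>"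
  using assms act_zero_left[of m]
  by (simp add: act_def Lambda_class_relation flip: Lambda_class_zero)

lemma act_cong_diff:
  assumes "act (f - g) m = \<zero>\<^bsub>M\<^esub>" "m \<in> carrier M"
  shows "act f m = act g m"
  using act_add[of m "f - g" g] assms by simp

lemma act_const_commute: "m \<in> carrier M \<Longrightarrow> act f (act (const c) m) = act (const c) (act f m)"
  by (simp add: const_mult_commute flip: act_mult)

lemma act_const_eq_0_iff:
  assumes "m \<in> carrier M"
  shows "act (const c) m = \<zero>\<^bsub>M\<^esub> \<longleftrightarrow> c = 0 \<or> m = \<zero>\<^bsub>M\<^esub>"
proof (cases "c = 0")
  case False
  then have "act (const (inverse c)) (act (const c) m) = m"
    using assms by (simp add: const_mult flip: act_mult)
  then show ?thesis using False assms by auto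
qed (use assms in simp)

lemma act_generators:
  fixes m
  assumes "m \<in> carrier M"
  shows act_xx: "act (gen X_gen) (act (gen X_gen) m) = \<zero>\<^bsub>M\<^esub>"
    and act_yy: "act (gen Y_gen) (act (gen Y_gen) m) = \<zero>\<^bsub>M\<^esub>"
    and act_zz: "act (gen Z_gen) (act (gen Z_gen) m) = \<zero>\<^bsub>M\<^esub>"
    and act_yz: "act (gen Y_gen) (act (gen Z_gen) m) = \<zero>\<^bsub>M\<^esub>"
    and act_xy: "act (gen X_gen) (act (gen Y_gen) m)
      = act (const (- q)) (act (gen Y_gen) (act (gen X_gen) m))"
    and act_xz: "act (gen X_gen) (act (gen Z_gen) m) = act (gen Z_gen) (act (gen X_gen) m)"
    and act_zy: "act (gen Z_gen) (act (gen Y_gen) m) = act (gen Z_gen) (act (gen X_gen) m)"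
proof -
  note rel = act_relation[OF _ assms, unfolded Lambda_relations_def Let_def]
  let ?x = "gen X_gen" and ?y = "gen Y_gen" and ?z = "gen Z_gen"
  have minus_q: "const (- q) = - const q"
    by (simp add: const_def single_uminus)
  show "act ?x (act ?x m) = \<zero>\<^bsub>M\<^esub>" "act ?y (act ?y m) = \<zero>\<^bsub>M\<^esub>" "act ?z (act ?z m) = \<zero>\<^bsub>M\<^esub>"
    "act ?y (act ?z m) = \<zero>\<^bsub>M\<^esub>"
    using rel assms by (simp_all flip: act_mult)
  show "act ?x (act ?y m) = act (const (- q)) (act ?y (act ?x m))"
    using act_cong_diff[OF _ assms, of "?x * ?y" "- const q * ?y * ?x"]
      rel[of "?x * ?y + const q * ?y * ?x"] assms
    by (simp add: minus_q mult.assoc flip: act_mult)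
  show "act ?x (act ?z m) = act ?z (act ?x m)"
    using act_cong_diff[OF rel assms, of "?x * ?z" "?z * ?x"] assms by (simp flip: act_mult)
  show "act ?z (act ?y m) = act ?z (act ?x m)"
    using act_cong_diff[OF rel assms, of "?z * ?y" "?z * ?x"] assms by (simp flip: act_mult)
qed

text \<open>A nonempty word applies its last letter first, and that letter already gives zero.\<close>

lemma act_eq_0_if_generators_kill:
  assumes "augmentation f = 0" and m: "m \<in> carrier M"
    and kill: "\<And>g. act (gen g) m = \<zero>\<^bsub>M\<^esub>"
  shows "act f m = \<zero>\<^bsub>M\<^esub>"
proof -
  have "Poly_Mapping.keys f \<subseteq> - {0}"
    using assms(1) by (auto simp: in_keys_iff)
  then show ?thesis
  proof (induction rule: poly_mapping_additive_induct)
    case (single w c)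
    then obtain u g where "w = Word (u @ [g])"
      by (metis ComplD free_monoid.exhaust insertI1 rev_exhaust zero_free_monoid_def)
    then show ?case
      using m kill by (simp add: single_snoc act_mult)
  qed (use m in \<open>simp_all add: act_add\<close>)
qed

text \<open>
  Multiplying a nonempty word by \<open>g\<close> from the left gives a word that begins with two letters,
  the second of which is the first letter of the given word.
\<close>

lemma generator_kills_act:
  assumes "augmentation f = 0" and m: "m \<in> carrier M"
    and kill: "\<And>h n. n \<in> carrier M \<Longrightarrow> act (gen g) (act (gen h) n) = \<zero>\<^bsub>M\<^esub>"
  shows "act (gen g) (act f m) = \<zero>\<^bsub>M\<^esub>"
proof -
  have "Poly_Mapping.keys f \<subseteq> - {0}"
    using assms(1) by (auto simp: in_keys_iff)
  then show ?thesis
  proof (induction rule: poly_mapping_additive_induct)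
    case (single w c)
    then obtain u h where "w = Word (h # u)"
      by (metis ComplD free_monoid.exhaust insertI1 list.exhaust zero_free_monoid_def)
    then show ?case
      using m kill by (simp add: single_Cons act_mult)
  qed (use m in \<open>simp_all add: act_add act_add_right\<close>)
qed

section \<open>Quantum exterior algebras force dimension four\<close>

text \<open>
  A relation between \<open>v\<close>, \<open>sv\<close>, \<open>tv\<close>, \<open>tsv\<close> is turned into a multiple of the nonzero vector \<open>tsv\<close> by
  multiplying it with the complementary monomial of the coefficient to be isolated: \<open>ts\<close> kills
  all terms but the first, then \<open>t\<close> isolates the second one and \<open>s\<close> the third one, as
  \<open>stv = c tsv\<close>.
\<close>

lemma independent_of_quantum_exterior:
  fixes s t v c
  defines "S \<equiv> act s" and "T \<equiv> act t"
  assumes v: "v \<in> carrier M" and c: "c \<noteq> 0"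
    and SS: "\<And>m. m \<in> carrier M \<Longrightarrow> S (S m) = \<zero>\<^bsub>M\<^esub>"
    and TT: "\<And>m. m \<in> carrier M \<Longrightarrow> T (T m) = \<zero>\<^bsub>M\<^esub>"
    and ST: "\<And>m. m \<in> carrier M \<Longrightarrow> S (T m) = act (const c) (T (S m))"
    and TS: "T (S v) \<noteq> \<zero>\<^bsub>M\<^esub>"
    and eq: "act (const \<alpha>) v \<oplus>\<^bsub>M\<^esub> (act (const \<beta>) (S v) \<oplus>\<^bsub>M\<^esub>
      (act (const \<gamma>) (T v) \<oplus>\<^bsub>M\<^esub> act (const \<delta>) (T (S v)))) = \<zero>\<^bsub>M\<^esub>"
  shows "\<alpha> = 0" "\<beta> = 0" "\<gamma> = 0" "\<delta> = 0"
proof -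
  have S [simp, intro]: "S m \<in> carrier M" and T [simp, intro]: "T m \<in> carrier M"
    if "m \<in> carrier M" for m using that by (simp_all add: S_def T_def)
  have S_add: "S (m \<oplus>\<^bsub>M\<^esub> n) = S m \<oplus>\<^bsub>M\<^esub> S n" and T_add: "T (m \<oplus>\<^bsub>M\<^esub> n) = T m \<oplus>\<^bsub>M\<^esub> T n"
    if "m \<in> carrier M" "n \<in> carrier M" for m n
    using that by (simp_all add: S_def T_def act_add_right)
  have S_const: "S (act (const d) m) = act (const d) (S m)"
    and T_const: "T (act (const d) m) = act (const d) (T m)" if "m \<in> carrier M" for d m
    using that by (simp_all add: S_def T_def act_const_commute)
  have zero [simp]: "S \<zero>\<^bsub>M\<^esub> = \<zero>\<^bsub>M\<^esub>" "T \<zero>\<^bsub>M\<^esub> = \<zero>\<^bsub>M\<^esub>"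
    by (simp_all add: S_def T_def)
  note rules = S_add T_add S_const T_const SS TT ST v act_const_eq_0_iff TS c
  show a: "\<alpha> = 0"
    using arg_cong[OF eq, of "\<lambda>m. T (S m)"] by (simp add: rules)
  show b: "\<beta> = 0"
    using arg_cong[OF eq, of T] by (simp add: rules a)
  show d: "\<gamma> = 0"
    using arg_cong[OF eq, of S] by (simp add: rules a b)
  show "\<delta> = 0"
    using eq by (simp add: rules a b d)
qed

lemma dim_ge_4_of_quantum_exterior:
  fixes s t v c
  assumes v: "v \<in> carrier M" and c: "c \<noteq> 0"
    and ss: "\<And>m. m \<in> carrier M \<Longrightarrow> act s (act s m) = \<zero>\<^bsub>M\<^esub>"
    and tt: "\<And>m. m \<in> carrier M \<Longrightarrow> act t (act t m) = \<zero>\<^bsub>M\<^esub>"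
    and st: "\<And>m. m \<in> carrier M \<Longrightarrow> act s (act t m) = act (const c) (act t (act s m))"
    and ts: "act t (act s v) \<noteq> \<zero>\<^bsub>M\<^esub>"
    and fin: "vectorspace.fin_dim ring_of_type_algebra (underlying_space q M)"
  shows "4 \<le> vectorspace.dim ring_of_type_algebra (underlying_space q M)"
proof -
  interpret V: vectorspace ring_of_type_algebra "underlying_space q M"
    by (rule vectorspace_underlying_space) (rule left_module_axioms)
  let ?S = "act s" and ?T = "act t"
  let ?A = "{v, ?S v, ?T v, ?T (?S v)}"
  have car: "carrier (underlying_space q M) = carrier M"
    and add: "a \<oplus>\<^bsub>underlying_space q M\<^esub> b = a \<oplus>\<^bsub>M\<^esub> b"
    and zero: "\<zero>\<^bsub>underlying_space q M\<^esub> = \<zero>\<^bsub>M\<^esub>"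
    and smult: "k \<odot>\<^bsub>underlying_space q M\<^esub> a = act (const k) a" for a b k
    by (simp_all add: restrict_scalars_def act_def Lambda_class_const)
  (* The vectors have to be distinct for a linear combination over their set to have four
     terms. For each of the six pairs, one of ts, t, s kills exactly one of the two vectors. *)
  have "?T (?S (?T v)) = \<zero>\<^bsub>M\<^esub>"
    using v by (simp add: st act_const_commute tt)
  moreover have "?T (?S (?T (?S v))) = \<zero>\<^bsub>M\<^esub>"
    using v by (simp add: st act_const_commute tt)
  moreover have "?S (?T v) \<noteq> \<zero>\<^bsub>M\<^esub>"
    using v c ts by (simp add: st act_const_eq_0_iff)
  moreover have "?S (?T (?S v)) = \<zero>\<^bsub>M\<^esub>"
    using v by (simp add: st ss)
  ultimately have dist: "v \<noteq> ?S v" "v \<noteq> ?T v" "v \<noteq> ?T (?S v)" "?S v \<noteq> ?T v"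
    "?S v \<noteq> ?T (?S v)" "?T v \<noteq> ?T (?S v)"
    using v ss[of v] tt[of v] tt[of "?S v"] ts act_zero_right by (metis act_closed)+
  have "V.lin_indpt ?A"
  proof (rule V.finite_lin_indpt2)
    show "?A \<subseteq> carrier (underlying_space q M)" using v by (auto simp: car)
    fix a assume "V.lincomb a ?A = \<zero>\<^bsub>underlying_space q M\<^esub>"
    then have "act (const (a v)) v \<oplus>\<^bsub>M\<^esub> (act (const (a (?S v))) (?S v) \<oplus>\<^bsub>M\<^esub>
      (act (const (a (?T v))) (?T v) \<oplus>\<^bsub>M\<^esub> act (const (a (?T (?S v)))) (?T (?S v)))) = \<zero>\<^bsub>M\<^esub>"
      using v dist
      by (simp add: V.lincomb_def V.M.finsum_insert car add zero smult Pi_def)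
    from independent_of_quantum_exterior[OF v c ss tt st ts this]
    show "\<forall>u\<in>?A. a u = \<zero>\<^bsub>ring_of_type_algebra\<^esub>"
      by (simp add: ring_of_type_algebra_def)
  qed simp
  then have "card ?A \<le> V.dim"
    using V.li_le_dim(2)[OF fin, of ?A] v by (simp add: car)
  then show ?thesis
    using dist by simp
qed

section \<open>Submodules and the radical\<close>

lemma submodule_iff:
  "Module.submodule U (Lambda q) M \<longleftrightarrow>
     U \<subseteq> carrier M \<and> \<zero>\<^bsub>M\<^esub> \<in> U \<and> (\<forall>a\<in>U. \<forall>b\<in>U. a \<oplus>\<^bsub>M\<^esub> b \<in> U) \<and> (\<forall>f. \<forall>a\<in>U. act f a \<in> U)"
  (is "?L \<longleftrightarrow> ?R")
proof
  assume ?L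
  then interpret U: Module.submodule U "Lambda q" M .
  show ?R
    using U.subset U.one_closed U.m_closed U.smult_closed
    by (auto simp: act_def)
next
  assume R: ?R
  have inv: "\<ominus>\<^bsub>M\<^esub> a = act (- 1) a" if "a \<in> carrier M" for a
    using act_minus_one that by (intro M.minus_equality) auto
  show ?L
  proof (intro Module.submodule.intro subgroup.intro Module.submodule_axioms.intro)
    fix a u assume "a \<in> carrier (Lambda q)" "u \<in> U"
    then show "a \<odot>\<^bsub>M\<^esub> u \<in> U" using R by (auto elim!: Lambda_classE simp: act_def)
  next
    fix u assume "u \<in> U"
    then have "\<ominus>\<^bsub>M\<^esub> u \<in> U" using R inv by auto
    then show "inv\<^bsub>add_monoid M\<^esub> u \<in> U" by (simp add: a_inv_def)
  qed (use R in auto)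
qed

text \<open>
  Modulo \<open>U\<close>, an element of the free algebra acts on \<open>n\<close> as its augmentation, so the subspace
  spanned by \<open>U\<close> and \<open>n\<close> is closed under the action.
\<close>

lemma submodule_add_line:
  assumes "Module.submodule U (Lambda q) M" and n: "n \<in> carrier M"
    and aug: "\<And>f. augmentation f = 0 \<Longrightarrow> act f n \<in> U"
  shows "Module.submodule {u \<oplus>\<^bsub>M\<^esub> act (const c) n |u c. u \<in> U} (Lambda q) M"
    (is "Module.submodule ?L _ _")
  unfolding submodule_iff
proof (intro conjI ballI allI)
  note U = assms(1)[unfolded submodule_iff]
  show "?L \<subseteq> carrier M" using U n by auto
  show "\<zero>\<^bsub>M\<^esub> \<in> ?L"
    using U n by (auto intro!: exI[of _ "\<zero>\<^bsub>M\<^esub>"] exI[of _ 0])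
next
  note U = assms(1)[unfolded submodule_iff]
  fix a b assume "a \<in> ?L" "b \<in> ?L"
  then obtain u c w d where *: "u \<in> U" "w \<in> U"
    "a = u \<oplus>\<^bsub>M\<^esub> act (const c) n" "b = w \<oplus>\<^bsub>M\<^esub> act (const d) n" by blast
  have "u \<in> carrier M" "w \<in> carrier M" using * U by auto
  then have "a \<oplus>\<^bsub>M\<^esub> b = (u \<oplus>\<^bsub>M\<^esub> w) \<oplus>\<^bsub>M\<^esub> act (const (c + d)) n"
    using n * by (simp add: const_add act_add M.a_ac)
  then show "a \<oplus>\<^bsub>M\<^esub> b \<in> ?L" using * U by blast
next
  note U = assms(1)[unfolded submodule_iff]
  fix f :: "(xyz, 'k) free_algebra" and a assume "a \<in> ?L"
  then obtain u c where *: "u \<in> U" "a = u \<oplus>\<^bsub>M\<^esub> act (const c) n" by blast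
  let ?e = "augmentation f"
  let ?h = "f * const c - const (?e * c)"
  have u: "u \<in> carrier M" using * U by auto
  have h: "act ?h n \<in> U"
    by (rule aug) (simp add: lookup_minus augmentation_mult)
  have "act f (act (const c) n) = act (?h + const (?e * c)) n"
    using n by (simp flip: act_mult)
  also have "\<dots> = act ?h n \<oplus>\<^bsub>M\<^esub> act (const (?e * c)) n"
    using n by (simp only: act_add)
  finally have "act f a = (act f u \<oplus>\<^bsub>M\<^esub> act ?h n) \<oplus>\<^bsub>M\<^esub> act (const (?e * c)) n"
    using n u * by (simp add: act_add_right M.a_assoc)
  moreover have "act f u \<oplus>\<^bsub>M\<^esub> act ?h n \<in> U" using * U h by blast
  ultimately show "act f a \<in> ?L" by blast
qed

lemma submodule_Union_chain:
  assumes "C \<noteq> {}" and sub: "\<And>U. U \<in> C \<Longrightarrow> Module.submodule U (Lambda q) M"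
    and lin: "\<And>U W. \<lbrakk>U \<in> C; W \<in> C\<rbrakk> \<Longrightarrow> U \<subseteq> W \<or> W \<subseteq> U"
  shows "Module.submodule (\<Union>C) (Lambda q) M"
  unfolding submodule_iff
proof (intro conjI ballI allI)
  note sub' = sub[unfolded submodule_iff]
  show "\<Union>C \<subseteq> carrier M" using sub' by blast
  show "\<zero>\<^bsub>M\<^esub> \<in> \<Union>C" using sub' assms(1) by blast
  show "act f a \<in> \<Union>C" if "a \<in> \<Union>C" for f a using sub' that by blast
  fix a b assume "a \<in> \<Union>C" "b \<in> \<Union>C"
  then obtain U W where UW: "U \<in> C" "a \<in> U" "W \<in> C" "b \<in> W" by blast
  from lin[OF UW(1,3)] show "a \<oplus>\<^bsub>M\<^esub> b \<in> \<Union>C"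
  proof
    assume "U \<subseteq> W"
    then have "a \<oplus>\<^bsub>M\<^esub> b \<in> W" using sub'[OF UW(3)] UW by blast
    then show ?thesis using UW by blast
  next
    assume "W \<subseteq> U"
    then have "a \<oplus>\<^bsub>M\<^esub> b \<in> U" using sub'[OF UW(1)] UW by blast
    then show ?thesis using UW by blast
  qed
qed

text \<open>
  By Zorn's lemma there is a submodule \<open>U\<close> that is maximal among those that contain \<open>P\<close> and avoid \<open>v\<close>.
  It is a hyperplane, since for \<open>n \<notin> U\<close> the submodule \<open>U + k n\<close> contains \<open>v\<close>, so that \<open>n \<in> U + k v\<close>.
  A submodule that properly contains \<open>U\<close> contains \<open>v\<close> and therefore everything.
\<close>

lemma maximal_submodule_avoiding:
  assumes P: "Module.submodule P (Lambda q) M" and v: "v \<in> carrier M" "v \<notin> P"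
    and aug: "\<And>f m. \<lbrakk>augmentation f = 0; m \<in> carrier M\<rbrakk> \<Longrightarrow> act f m \<in> P"
  obtains U where "maximal_submodule U (Lambda q) M" "v \<notin> U"
proof -
  let ?A = "{U. Module.submodule U (Lambda q) M \<and> P \<subseteq> U \<and> v \<notin> U}"
  have "\<exists>U\<in>?A. \<forall>W\<in>?A. U \<subseteq> W \<longrightarrow> W = U"
  proof (rule subset_Zorn_nonempty)
    show "?A \<noteq> {}" using P v by auto
    fix C assume C: "C \<noteq> {}" "subset.chain ?A C"
    then have "\<And>U. U \<in> C \<Longrightarrow> U \<in> ?A"
      and "\<And>U W. \<lbrakk>U \<in> C; W \<in> C\<rbrakk> \<Longrightarrow> U \<subseteq> W \<or> W \<subseteq> U"
      by (auto simp: subset_chain_def)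
    then show "\<Union>C \<in> ?A"
      using C(1) submodule_Union_chain[of C] by fastforce
  qed
  then obtain U where U: "Module.submodule U (Lambda q) M" "P \<subseteq> U" "v \<notin> U"
    and max: "\<And>W. \<lbrakk>Module.submodule W (Lambda q) M; U \<subseteq> W; v \<notin> W\<rbrakk> \<Longrightarrow> W = U"
    by auto
  note U' = U(1)[unfolded submodule_iff]
  have "W = U \<or> W = carrier M" if W: "Module.submodule W (Lambda q) M" "U \<subseteq> W" for W
  proof (rule ccontr)
    note W' = W(1)[unfolded submodule_iff]
    assume neq: "\<not> (W = U \<or> W = carrier M)"
    then have vW: "v \<in> W" using max W by blast
    obtain n where n: "n \<in> carrier M" "n \<notin> W" using W' neq by auto
    let ?L = "{u \<oplus>\<^bsub>M\<^esub> act (const c) n |u c. u \<in> U}"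
    have "U \<subseteq> ?L"
    proof
      fix u assume "u \<in> U"
      moreover have "u = u \<oplus>\<^bsub>M\<^esub> act (const 0) n" using \<open>u \<in> U\<close> U' n by auto
      ultimately show "u \<in> ?L" by blast
    qed
    moreover have "n \<in> ?L"
      using U' n by (auto intro!: exI[of _ "\<zero>\<^bsub>M\<^esub>"] exI[of _ 1])
    moreover have "Module.submodule ?L (Lambda q) M"
      using submodule_add_line[OF U(1) n(1)] aug n(1) U(2) by blast
    ultimately have "v \<in> ?L" using max[of ?L] n W(2) by blast
    then obtain u c where uc: "u \<in> U" "v = u \<oplus>\<^bsub>M\<^esub> act (const c) n" by blast
    have u: "u \<in> carrier M" "act (- 1) u \<in> W" using uc U' W W' by auto
    have "c \<noteq> 0" using uc u U(3) n by auto
    have "act (const c) n = act (- 1) u \<oplus>\<^bsub>M\<^esub> v"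
      using uc u n act_minus_one[of u] by (simp flip: M.a_assoc)
    then have "act (const c) n \<in> W" using W' u vW by simp
    then have "act (const (inverse c)) (act (const c) n) \<in> W" using W' by blast
    then show False
      using n \<open>c \<noteq> 0\<close> by (simp add: const_mult flip: act_mult)
  qed
  moreover have "U \<noteq> carrier M" using U v by auto
  ultimately have "maximal_submodule U (Lambda q) M"
    using U by (simp add: maximal_submodule_def)
  with U(3) show thesis using that by blast
qed

text \<open>
  The quotient by \<open>P\<close> is semisimple, because only scalars act on it: each vector outside \<open>P\<close> is
  avoided by a maximal submodule.
\<close>

lemma module_radical_subset:
  assumes "Module.submodule P (Lambda q) M"
    and "\<And>f m. \<lbrakk>augmentation f = 0; m \<in> carrier M\<rbrakk> \<Longrightarrow> act f m \<in> P"
  shows "module_radical (Lambda q) M \<subseteq> P"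
proof
  fix v assume v: "v \<in> module_radical (Lambda q) M"
  show "v \<in> P"
  proof (rule ccontr)
    assume "v \<notin> P"
    moreover have "v \<in> carrier M" using v by (simp add: module_radical_def)
    ultimately obtain U where "maximal_submodule U (Lambda q) M" "v \<notin> U"
      using maximal_submodule_avoiding assms by metis
    then show False using v by (auto simp: module_radical_def)
  qed
qed

lemma submodule_module_radical: "Module.submodule (module_radical (Lambda q) M) (Lambda q) M"
proof -
  have "Module.submodule U (Lambda q) M" if "maximal_submodule U (Lambda q) M" for U
    using that by (simp add: maximal_submodule_def)
  then show ?thesis
    unfolding submodule_iff module_radical_def by auto
qed

text \<open>
  The second step of the radical series is the radical of \<open>rad M\<close> as a module in its own right, so
  the criterion for radicals has to be available there.
\<close>

lemma Lambda_module_submodule: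
  assumes "Module.submodule N (Lambda q) M"
  shows "Lambda_module q (M\<lparr>carrier := N\<rparr>)"
proof -
  note N = assms[unfolded submodule_iff]
  have car: "\<And>n. n \<in> N \<Longrightarrow> n \<in> carrier M" using N by auto
  have "abelian_group (M\<lparr>carrier := N\<rparr>)"
    using N act_minus_one by (intro abelian_groupI) (auto simp: M.a_ac car intro!: bexI[of _ "act (- 1) _"])
  moreover have "a \<odot>\<^bsub>M\<^esub> n \<in> N" if "a \<in> carrier (Lambda q)" "n \<in> N" for a n
    using N that by (auto elim!: Lambda_classE simp: act_def)
  ultimately show ?thesis
    by (intro Lambda_module.intro left_module.intro left_module_axioms.intro ring_Lambda)
      (auto simp: car smult_l_distr smult_r_distr smult_assoc1)
qed

end

section \<open>The radical of \<open>\<Lambda>(q)\<close>\<close>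

lemma left_module_regular_module:
  assumes "ring R"
  shows "left_module R (regular_module R)"
proof -
  interpret ring R by fact
  have "abelian_group (regular_module R)"
    by (rule abelian_groupI)
      (auto simp: regular_module_def a_ac intro: l_neg intro!: bexI[where x = "\<ominus>\<^bsub>R\<^esub> x" for x])
  then show ?thesis
    by (intro left_module.intro left_module_axioms.intro assms)
      (auto simp: regular_module_def l_distr r_distr m_assoc)
qed

text \<open>
  The classes of augmentation zero form a left ideal, and they also absorb multiplication from
  the right, so elements of augmentation zero map the regular module into this left ideal.
\<close>

lemma ring_radical_Lambda_subset:
  "ring_radical (Lambda q) \<subseteq> {Lambda_class q f |f. augmentation f = 0}" (is "_ \<subseteq> ?P")
proof -
  interpret Lambda_module q "regular_module (Lambda q)"
    by (intro Lambda_module.intro left_module_regular_module ring_Lambda)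
  have [simp]: "carrier (regular_module (Lambda q)) = carrier (Lambda q)"
    "\<zero>\<^bsub>regular_module (Lambda q)\<^esub> = Lambda_class q 0"
    "Lambda_class q f \<oplus>\<^bsub>regular_module (Lambda q)\<^esub> Lambda_class q g = Lambda_class q (f + g)"
    for f g
    by (simp_all add: regular_module_def Lambda_class_zero Lambda_class_add)
  have [simp]: "act f (Lambda_class q g) = Lambda_class q (f * g)" for f g
    by (simp add: act_def Lambda_class_mult) (simp add: regular_module_def)
  have "Module.submodule ?P (Lambda q) (regular_module (Lambda q))"
    unfolding submodule_iff
  proof (intro conjI ballI allI)
    show "\<zero>\<^bsub>regular_module (Lambda q)\<^esub> \<in> ?P"
      by (auto intro!: exI[of _ 0])
  next
    fix a b assume "a \<in> ?P" "b \<in> ?P"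
    then obtain f g where "a = Lambda_class q f" "b = Lambda_class q g"
      "augmentation f = 0" "augmentation g = 0" by blast
    then show "a \<oplus>\<^bsub>regular_module (Lambda q)\<^esub> b \<in> ?P"
      by (auto intro!: exI[of _ "f + g"] simp: lookup_add)
  next
    fix f a assume "a \<in> ?P"
    then obtain g where "a = Lambda_class q g" "augmentation g = 0" by blast
    then show "act f a \<in> ?P"
      by (auto intro!: exI[of _ "f * g"] simp: augmentation_mult)
  qed auto
  moreover have "act f m \<in> ?P" if "augmentation f = 0" "m \<in> carrier (regular_module (Lambda q))" for f m
  proof -
    obtain g where "m = Lambda_class q g" using \<open>m \<in> _\<close> by (auto elim: Lambda_classE)
    then show ?thesis
      using that by (auto intro!: exI[of _ "f * g"] simp: augmentation_mult)
  qed
  ultimately show ?thesis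
    unfolding ring_radical_def by (rule module_radical_subset)
qed

section \<open>Modules of dimension at most three\<close>

lemma (in Lambda_module) generators_mult_zero_of_dim_le_3:
  assumes "q \<noteq> 0"
    and fin: "vectorspace.fin_dim ring_of_type_algebra (underlying_space q M)"
    and dim: "vectorspace.dim ring_of_type_algebra (underlying_space q M) \<le> 3"
    and m: "m \<in> carrier M"
  shows "act (gen g) (act (gen h) m) = \<zero>\<^bsub>M\<^esub>"
proof -
  have "act (gen Y_gen) (act (gen X_gen) m) = \<zero>\<^bsub>M\<^esub>"
  proof (rule ccontr)
    assume "act (gen Y_gen) (act (gen X_gen) m) \<noteq> \<zero>\<^bsub>M\<^esub>"
    from dim_ge_4_of_quantum_exterior[OF m _ act_xx act_yy act_xy this fin] show False
      using \<open>q \<noteq> 0\<close> dim by simp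
  qed
  moreover have "act (gen Z_gen) (act (gen X_gen) m) = \<zero>\<^bsub>M\<^esub>"
  proof (rule ccontr)
    assume ne: "act (gen Z_gen) (act (gen X_gen) m) \<noteq> \<zero>\<^bsub>M\<^esub>"
    have "act (gen X_gen) (act (gen Z_gen) n) = act (const 1) (act (gen Z_gen) (act (gen X_gen) n))"
      if "n \<in> carrier M" for n using act_xz that by simp
    from dim_ge_4_of_quantum_exterior[OF m one_neq_zero act_xx act_zz this ne fin] show False
      using dim by simp
  qed
  ultimately show ?thesis
    using act_generators[OF m] by (cases g; cases h) auto
qed

theorem proposition1:
  fixes q :: "'k::field"
    and M :: "((xyz, 'k) free_algebra set, 'm) module"
  assumes "q \<noteq> 0"
    and "left_module (Lambda q) M"
    and "vectorspace.fin_dim ring_of_type_algebra (underlying_space q M)"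
    and "vectorspace.dim ring_of_type_algebra (underlying_space q M) \<le> 3"
  shows "(\<forall>a \<in> ideal_prod (Lambda q) (ring_radical (Lambda q)) (ring_radical (Lambda q)).
           \<forall>m \<in> carrier M. a \<odot>\<^bsub>M\<^esub> m = \<zero>\<^bsub>M\<^esub>)
       \<and> loewy_length (Lambda q) M \<le> 2"
proof
  interpret Lambda_module q M by (rule Lambda_module.intro) fact
  note words = generators_mult_zero_of_dim_le_3[OF assms(1,3,4)]
  have gen_aug: "act (gen g) (act f m) = \<zero>\<^bsub>M\<^esub>"
    if "augmentation f = 0" "m \<in> carrier M" for g f m
    using that words by (rule generator_kills_act)
  have aug2: "act f (act g m) = \<zero>\<^bsub>M\<^esub>"
    if "augmentation f = 0" "augmentation g = 0" "m \<in> carrier M" for f g m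
    using that(1) act_closed[OF that(3)] gen_aug[OF that(2,3)]
    by (rule act_eq_0_if_generators_kill)
  show "\<forall>a \<in> ideal_prod (Lambda q) (ring_radical (Lambda q)) (ring_radical (Lambda q)).
      \<forall>m \<in> carrier M. a \<odot>\<^bsub>M\<^esub> m = \<zero>\<^bsub>M\<^esub>"
  proof
    fix a assume "a \<in> ideal_prod (Lambda q) (ring_radical (Lambda q)) (ring_radical (Lambda q))"
    then have "a \<in> carrier (Lambda q) \<and> (\<forall>m \<in> carrier M. a \<odot>\<^bsub>M\<^esub> m = \<zero>\<^bsub>M\<^esub>)"
    proof induction
      case (prod i j)
      then obtain f g where "i = Lambda_class q f" "j = Lambda_class q g"
        "augmentation f = 0" "augmentation g = 0"
        using ring_radical_Lambda_subset by blast
      then show ?case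
        using aug2[of f g] by (auto simp: act_def smult_assoc1)
    next
      case (sum a b)
      then show ?case by (simp add: smult_l_distr)
    qed
    then show "\<forall>m \<in> carrier M. a \<odot>\<^bsub>M\<^esub> m = \<zero>\<^bsub>M\<^esub>" by blast
  qed
  (* The largest submodule on which only scalars act. Elements of augmentation zero map M
     into it because all words of length two vanish on M. *)
  let ?S = "{m \<in> carrier M. \<forall>g. act (gen g) m = \<zero>\<^bsub>M\<^esub>}"
  let ?N = "module_radical (Lambda q) M"
  have "?N \<subseteq> ?S"
  proof (rule module_radical_subset)
    show "act f m \<in> ?S" if "augmentation f = 0" "m \<in> carrier M" for f m
      using that gen_aug by simp
    have "act (gen g) (act f m) = \<zero>\<^bsub>M\<^esub>" if "m \<in> ?S" for f g m
    proof -
      have m: "m \<in> carrier M" using that by simp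
      have "act (gen g * f) m = \<zero>\<^bsub>M\<^esub>"
        by (rule act_eq_0_if_generators_kill) (use that in \<open>simp_all add: augmentation_mult\<close>)
      then show ?thesis using m by (simp add: act_mult)
    qed
    then show "Module.submodule ?S (Lambda q) M"
      unfolding submodule_iff by (auto simp: act_add_right)
  qed
  interpret N: Lambda_module q "M\<lparr>carrier := ?N\<rparr>"
    by (rule Lambda_module_submodule) (rule submodule_module_radical)
  have N_act: "N.act = act"
    by (simp add: fun_eq_iff N.act_def act_def)
  have "module_radical (Lambda q) (M\<lparr>carrier := ?N\<rparr>) \<subseteq> {\<zero>\<^bsub>M\<^esub>}"
  proof (rule N.module_radical_subset)
    show "Module.submodule {\<zero>\<^bsub>M\<^esub>} (Lambda q) (M\<lparr>carrier := ?N\<rparr>)"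
      using N.M.zero_closed unfolding N.submodule_iff N_act by auto
    show "N.act f m \<in> {\<zero>\<^bsub>M\<^esub>}"
      if "augmentation f = 0" "m \<in> carrier (M\<lparr>carrier := ?N\<rparr>)" for f m
      using that \<open>?N \<subseteq> ?S\<close> act_eq_0_if_generators_kill[of f m] by (auto simp: N_act)
  qed
  moreover have "\<zero>\<^bsub>M\<^esub> \<in> module_radical (Lambda q) (M\<lparr>carrier := ?N\<rparr>)"
    using N.submodule_module_radical unfolding N.submodule_iff by simp
  ultimately have "radical_series (Lambda q) M 2 = {\<zero>\<^bsub>M\<^esub>}"
    by (auto simp: numeral_2_eq_2)
  then have "loewy_length (Lambda q) M \<le> enat 2"
    unfolding loewy_length_def by (intro INF_lower) simp
  then show "loewy_length (Lambda q) M \<le> 2"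
    by (simp add: numeral_eq_enat)
qed

end
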